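(* Let $d\ge 1$ be an integer and let $\varepsilon\in[0,1]$. For every $\delta>0$, $$\lim_{n\to+\infty}\mathbb{P}\left(\left|\lim_{T\to+\infty}\ell^T(\omega^n_\varepsilon)-\varepsilon\right|\ge\delta\right)=0.$$
   Context: Let $M=\mathbb{T}^d=\mathbb{R}^d/\mathbb{Z}^d$ be the flat torus and let $\Gamma$ be the set of its unit-speed geodesics, i.e. curves $\gamma(t)=x+tv \bmod \mathbb{Z}^d$ with $x\in\mathbb{R}^d$, $v\in\mathbb{R}^d$, $|v|=1$ (Euclidean norm). For $T>0$, a measurable set $\omega\subset M$ and $\gamma\in\Gamma$, put $$m^T_\gamma(\omega)=\frac1T\int_0^T \mathbf{1}_\omega(\gamma(t))\,dt,\qquad \ell^T(\omega)=\inf_{\gamma\in\Gamma}m^T_\gamma(\omega).$$ It is known that $\lim_{T\to+\infty}\ell^T(\omega)$ exists. Random checkerboard: for an integer $n\ge1$, divide $[0,1]^d$ (viewed in $M$, indices taken modulo $n$) into the $n^d$ closed cells $c_{i_1,\dots,i_d}=\left[\frac{i_1-1}{n},\frac{i_1}{n}\right]\times\dots\times\left[\frac{i_d-1}{n},\frac{i_d}{n}\right]$, $1\le i_1,\dots,i_d\le n$. Let $(X_{i_1,\dots,i_d})$ be $n^d$ independent Bernoulli random variables with parameter $\varepsilon$. Then $\omega^n_\varepsilon$ is the union of all cells $c_{i_1,\dots,i_d}$ with $X_{i_1,\dots,i_d}=1$. *)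

theory Defs
  imports "HOL-Probability.Probability"
begin

definition lattice_rel :: "real ^ 'd \<Rightarrow> real ^ 'd \<Rightarrow> bool" where
  "lattice_rel x y \<longleftrightarrow> (\<forall>k. x $ k - y $ k \<in> \<int>)"

text \<open>The flat torus, with quotient map \<open>abs_torus\<close>. The dimension is the cardinality of the
  index type \<open>'d\<close>, which is finite and nonempty.\<close>

quotient_type (overloaded) 'd torus = "real ^ 'd" / lattice_rel
proof (rule equivpI)
  show "reflp (lattice_rel :: real ^ 'd \<Rightarrow> _)"
    by (simp add: reflp_def lattice_rel_def)
  show "symp (lattice_rel :: real ^ 'd \<Rightarrow> _)"
    unfolding symp_def lattice_rel_def by (metis Ints_minus minus_diff_eq)
  show "transp (lattice_rel :: real ^ 'd \<Rightarrow> _)"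
    unfolding transp_def lattice_rel_def by (metis Ints_add diff_add_cancel add_diff_eq)
qed

definition geodesics :: "(real \<Rightarrow> 'd::finite torus) set" where
  "geodesics = {\<gamma>. \<exists>x v. norm v = 1 \<and> \<gamma> = (\<lambda>t. abs_torus (x + t *\<^sub>R v))}"

definition mean_time :: "real \<Rightarrow> (real \<Rightarrow> 'd::finite torus) \<Rightarrow> 'd torus set \<Rightarrow> real" where
  "mean_time T \<gamma> \<omega> = 1 / T * (LBINT t:{0..T}. indicator \<omega> (\<gamma> t))"

definition ell :: "real \<Rightarrow> 'd::finite torus set \<Rightarrow> real" where
  "ell T \<omega> = (INF \<gamma>\<in>geodesics. mean_time T \<gamma> \<omega>)"

definition cell_indices :: "nat \<Rightarrow> ('d::finite \<Rightarrow> nat) set" where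
  "cell_indices n = {i. \<forall>k. i k \<in> {1..n}}"

definition cell :: "nat \<Rightarrow> ('d::finite \<Rightarrow> nat) \<Rightarrow> 'd torus set" where
  "cell n i = abs_torus ` cbox (\<chi> k. (real (i k) - 1) / real n) (\<chi> k. real (i k) / real n)"

definition checkerboard :: "nat \<Rightarrow> (('d::finite \<Rightarrow> nat) \<Rightarrow> bool) \<Rightarrow> 'd torus set" where
  "checkerboard n x = (\<Union>i\<in>{i \<in> cell_indices n. x i}. cell n i)"

text \<open>Bernoulli variables are valued in \<open>bool\<close>, as in \<^const>\<open>bernoulli_pmf\<close>, with \<open>True\<close> in the
  role of 1. Only the values \<open>X i\<close> with \<open>i \<in> cell_indices n\<close> matter.\<close>

definition iid_bernoulli_cells ::
    "'a measure \<Rightarrow> nat \<Rightarrow> real \<Rightarrow> (('d::finite \<Rightarrow> nat) \<Rightarrow> 'a \<Rightarrow> bool) \<Rightarrow> bool" where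
  "iid_bernoulli_cells M n \<epsilon> X \<longleftrightarrow>
     prob_space.indep_vars M (\<lambda>_. count_space UNIV) X (cell_indices n) \<and>
     (\<forall>i\<in>cell_indices n. distr M (count_space UNIV) (X i) = measure_pmf (bernoulli_pmf \<epsilon>))"

end

theory Submission imports Defs begin

text \<open>
  The total time that the worst geodesic spends in \<open>\<omega>\<close> is superadditive in \<open>T\<close>, because a geodesic
  run of length \<open>S + T\<close> is a run of length \<open>S\<close> followed by another geodesic run of length \<open>T\<close>. As in
  Fekete's lemma, \<open>ell T \<omega>\<close> therefore converges to its supremum over \<open>T > 0\<close>. So an upper bound on
  the limit has to be proved for all \<open>T\<close>, while for a lower bound a single \<open>T\<close> of our choice is
  enough (\<open>Lim_ell_le\<close>, \<open>ell_le_Lim_ell\<close>).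

  For the upper bound, average over the \<open>n\<^sup>d\<close> translates of one geodesic, with direction
  \<open>(1, \<dots>, 1)\<close>, by the vectors of the grid of mesh \<open>1/n\<close>. At almost every time these translates
  occupy every cell exactly once, so their mean time average is the proportion of selected cells,
  and the infimum is not larger (\<open>ell_checkerboard_le_density\<close>). This proportion is a mean of
  independent Bernoulli variables.

  For the lower bound, take \<open>T\<close> close to \<open>1/2\<close> and sample a geodesic at \<open>N \<approx> n/(2d)\<close> times with
  spacing \<open>h = d/n\<close>, starting from some phase \<open>s \<in> [0, h]\<close>. Integrating over the phase recovers the
  time average, so it suffices that for every sample the proportion of selected cells among the
  \<open>N\<close> visited ones is at least \<open>\<epsilon> - \<delta>/2\<close> (\<open>Lim_ell_checkerboard_ge\<close>). The spacing is so large that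
  consecutive samples leave the cell, and \<open>T\<close> is so small that the geodesic does not wrap around the
  torus, hence the \<open>N\<close> cells are distinct (\<open>inj_on_sample_cells\<close>) and Hoeffding's inequality bounds
  the failure probability of one sample by \<open>exp (- N \<delta>\<^sup>2 / 2)\<close>. Although there are uncountably many
  geodesics, only polynomially many sets of cells arise in this way: along each coordinate, the
  cells form a digital line \<open>j \<mapsto> \<lfloor>a + j b\<rfloor>\<close> modulo \<open>n\<close>, and a digital line of length \<open>N\<close> is determined
  by one of its lattice points and two rational approximations of \<open>b\<close> with denominators at most \<open>N\<close>
  (\<open>card_digital_lines\<close>). A union bound finishes the proof, the exponential beating the polynomial.
\<close>

section \<open>Time averages along geodesics\<close>

text \<open>The part of measurability of \<open>\<omega>\<close> that time averages see: every geodesic visits \<open>\<omega>\<close> in a Borel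
  set of times, so that \<^const>\<open>mean_time\<close> is a genuine integral instead of the default value of a
  nonintegrable function.\<close>

definition geodesically_measurable :: "'d::finite torus set \<Rightarrow> bool" where
  "geodesically_measurable \<omega> \<longleftrightarrow> (\<forall>\<gamma>\<in>geodesics. {t. \<gamma> t \<in> \<omega>} \<in> sets borel)"

lemma geodesic_shift:
  assumes "\<gamma> \<in> geodesics"
  shows "(\<lambda>t. \<gamma> (s + t)) \<in> geodesics"
proof -
  obtain x v where "norm v = 1" "\<gamma> = (\<lambda>t. abs_torus (x + t *\<^sub>R v))"
    using assms by (auto simp: geodesics_def)
  then have "(\<lambda>t. \<gamma> (s + t)) = (\<lambda>t. abs_torus ((x + s *\<^sub>R v) + t *\<^sub>R v))"
    by (simp add: algebra_simps)
  with \<open>norm v = 1\<close> show ?thesis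
    unfolding geodesics_def by blast
qed

lemma geodesics_nonempty: "geodesics \<noteq> ({} :: (real \<Rightarrow> 'd::finite torus) set)"
proof -
  obtain v :: "real ^ 'd" where "norm v = 1"
    using vector_choose_size[of 1] by auto
  then show ?thesis
    unfolding geodesics_def by auto
qed

lemma set_integrable_indicator_geodesic:
  assumes "geodesically_measurable \<omega>" "\<gamma> \<in> geodesics"
  shows "set_integrable lborel {a..b::real} (\<lambda>t. indicator \<omega> (\<gamma> t) :: real)"
proof -
  have "{t. \<gamma> t \<in> \<omega>} \<in> sets borel"
    using assms by (auto simp: geodesically_measurable_def)
  then have "{a..b} \<inter> {t. \<gamma> t \<in> \<omega>} \<in> sets lborel"
    by auto
  moreover have "emeasure lborel ({a..b} \<inter> {t. \<gamma> t \<in> \<omega>}) < \<infinity>"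
    by (rule le_less_trans[OF emeasure_mono[of _ "{a..b}"]]) (auto simp: emeasure_lborel_Icc_eq)
  ultimately have "integrable lborel (indicator ({a..b} \<inter> {t. \<gamma> t \<in> \<omega>}) :: real \<Rightarrow> real)"
    by (simp add: integrable_indicator_iff)
  also have "indicator ({a..b} \<inter> {t. \<gamma> t \<in> \<omega>}) =
      (\<lambda>t. indicator {a..b} t *\<^sub>R indicator \<omega> (\<gamma> t) :: real)"
    by (auto simp: indicator_def fun_eq_iff)
  finally show ?thesis
    by (simp add: set_integrable_def)
qed

lemma
  assumes "geodesically_measurable \<omega>" "\<gamma> \<in> geodesics"
  shows indicator_geodesic_integrable:
      "(\<lambda>t. indicator \<omega> (\<gamma> t) :: real) integrable_on {a..b::real}"
    and mean_time_eq: "mean_time T \<gamma> \<omega> = integral {0..T} (\<lambda>t. indicator \<omega> (\<gamma> t)) / T"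
  using set_borel_integral_eq_integral[OF set_integrable_indicator_geodesic[OF assms]]
  by (auto simp: mean_time_def)

lemma mean_time_bounds:
  assumes "geodesically_measurable \<omega>" "\<gamma> \<in> geodesics" "T > 0"
  shows "0 \<le> mean_time T \<gamma> \<omega>" "mean_time T \<gamma> \<omega> \<le> 1"
proof -
  let ?f = "\<lambda>t. indicator \<omega> (\<gamma> t) :: real"
  have "0 \<le> integral {0..T} ?f"
    by (intro integral_nonneg indicator_geodesic_integrable assms) auto
  moreover have "integral {0..T} ?f \<le> integral {0..T} (\<lambda>_. 1)"
    by (intro integral_le indicator_geodesic_integrable assms) (auto simp: indicator_def)
  ultimately show "0 \<le> mean_time T \<gamma> \<omega>" "mean_time T \<gamma> \<omega> \<le> 1"
    using \<open>T > 0\<close> by (auto simp: mean_time_eq[OF assms(1,2)])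
qed

lemma ell_le_mean_time:
  assumes "geodesically_measurable \<omega>" "\<gamma> \<in> geodesics" "T > 0"
  shows "ell T \<omega> \<le> mean_time T \<gamma> \<omega>"
  unfolding ell_def using assms mean_time_bounds(1)
  by (intro cINF_lower bdd_belowI2[of _ 0]) auto

lemma ell_ge:
  assumes "\<And>\<gamma>. \<gamma> \<in> geodesics \<Longrightarrow> c \<le> mean_time T \<gamma> \<omega>"
  shows "c \<le> ell T \<omega>"
  unfolding ell_def using assms geodesics_nonempty by (intro cINF_greatest) auto

lemma ell_bounds:
  fixes \<omega> :: "'d::finite torus set"
  assumes "geodesically_measurable \<omega>" "T > 0"
  shows "0 \<le> ell T \<omega>" "ell T \<omega> \<le> 1"
proof -
  show "0 \<le> ell T \<omega>"
    using assms by (intro ell_ge mean_time_bounds)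
  obtain \<gamma> :: "real \<Rightarrow> 'd torus" where "\<gamma> \<in> geodesics"
    using geodesics_nonempty by blast
  then show "ell T \<omega> \<le> 1"
    using ell_le_mean_time mean_time_bounds(2) assms by (meson order_trans)
qed

lemma integral_blocks:
  fixes f :: "real \<Rightarrow> real"
  assumes int: "\<And>a b. f integrable_on {a..b}" and "h \<ge> 0"
  shows "integral {0..real q * h} f = (\<Sum>j<q. integral {0..h} (\<lambda>t. f (real j * h + t)))"
proof (induction q)
  case (Suc q)
  have "integral {0..real (Suc q) * h} f =
      integral {0..real q * h} f + integral {real q * h..real (Suc q) * h} f"
    using \<open>h \<ge> 0\<close>
    by (intro Henstock_Kurzweil_Integration.integral_combine[symmetric] int)
       (auto intro: mult_right_mono)
  moreover have "((f \<circ> (+) (real q * h)) has_integral integral {real q * h..real (Suc q) * h} f) {0..h}"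
    unfolding has_integral_shift_Icc_real
    using integrable_integral[OF int[of "real q * h" "real (Suc q) * h"]]
    by (simp add: algebra_simps)
  then have "integral {0..h} (\<lambda>t. f (real q * h + t)) = integral {real q * h..real (Suc q) * h} f"
    by (simp add: o_def integral_unique)
  ultimately show ?case
    using Suc by simp
qed auto

text \<open>Cut the run \<open>{0..T}\<close> into \<open>q\<close> disjoint blocks of length \<open>S\<close>. On each block the geodesic, with its
  time shifted, is again a geodesic, so it spends at least time \<open>S * ell S \<omega>\<close> in \<open>\<omega>\<close>; the remaining
  piece contributes a nonnegative amount.\<close>

lemma blocks_times_ell_le_time_in_set:
  assumes meas: "geodesically_measurable \<omega>" and \<gamma>: "\<gamma> \<in> geodesics" and "S > 0"
    and T: "real q * S \<le> T"
  shows "real q * S * ell S \<omega> \<le> T * mean_time T \<gamma> \<omega>"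
proof (cases "T = 0")
  case True
  with T \<open>S > 0\<close> show ?thesis
    by (simp add: mult_le_0_iff)
next
  case False
  let ?f = "\<lambda>t. indicator \<omega> (\<gamma> t) :: real"
  have block: "S * ell S \<omega> \<le> integral {0..S} (\<lambda>t. ?f (real j * S + t))" for j
    using ell_le_mean_time[OF meas geodesic_shift[OF \<gamma>, of "real j * S"] \<open>S > 0\<close>] \<open>S > 0\<close>
    unfolding mean_time_eq[OF meas geodesic_shift[OF \<gamma>]] by (simp add: pos_le_divide_eq mult.commute)
  have "real q * S * ell S \<omega> = (\<Sum>j<q. S * ell S \<omega>)"
    by simp
  also have "\<dots> \<le> (\<Sum>j<q. integral {0..S} (\<lambda>t. ?f (real j * S + t)))"
    by (intro sum_mono block)
  also have "\<dots> = integral {0..real q * S} ?f"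
    using \<open>S > 0\<close> by (intro integral_blocks[symmetric] indicator_geodesic_integrable meas \<gamma>) auto
  also have "\<dots> \<le> integral {0..T} ?f"
    using T by (intro integral_subset_le indicator_geodesic_integrable meas \<gamma>) auto
  also have "\<dots> = T * mean_time T \<gamma> \<omega>"
    using False by (simp add: mean_time_eq[OF meas \<gamma>])
  finally show ?thesis .
qed

text \<open>Fekete's argument. If \<open>ell S \<omega> > a\<close>, then the blocks of length \<open>S\<close> cover all of \<open>{0..T}\<close> but a piece
  shorter than \<open>S\<close>, which gives \<open>ell T \<omega> \<ge> (1 - S / T) * ell S \<omega> > a\<close> for all large \<open>T\<close>.\<close>

lemma ell_tendsto_Sup:
  assumes meas: "geodesically_measurable \<omega>"
  shows "((\<lambda>T. ell T \<omega>) \<longlongrightarrow> (SUP S\<in>{0<..}. ell S \<omega>)) at_top"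
proof -
  have bdd: "bdd_above ((\<lambda>S. ell S \<omega>) ` {0<..})"
    using ell_bounds(2)[OF meas] by (intro bdd_aboveI2[of _ _ 1]) auto
  show ?thesis
  proof (rule order_tendstoI)
    fix a assume "a > (SUP S\<in>{0<..}. ell S \<omega>)"
    moreover have "\<forall>\<^sub>F T in at_top. ell T \<omega> \<le> (SUP S\<in>{0<..}. ell S \<omega>)"
      using eventually_gt_at_top[of 0] by eventually_elim (intro cSUP_upper bdd, auto)
    ultimately show "\<forall>\<^sub>F T in at_top. ell T \<omega> < a"
      by (auto elim!: eventually_mono)
  next
    fix a assume "a < (SUP S\<in>{0<..}. ell S \<omega>)"
    then obtain S where S: "S > 0" "a < ell S \<omega>"
      using less_cSUP_iff[OF _ bdd] by auto
    let ?g = "\<lambda>T. (1 - S / T) * ell S \<omega>"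
    have "(?g \<longlongrightarrow> (1 - 0) * ell S \<omega>) at_top"
      by (intro tendsto_intros tendsto_divide_0[OF tendsto_const] filterlim_at_top_imp_at_infinity
            filterlim_ident)
    then have "\<forall>\<^sub>F T in at_top. a < ?g T"
      using S(2) by (intro order_tendstoD(1)) auto
    then show "\<forall>\<^sub>F T in at_top. a < ell T \<omega>"
      using eventually_gt_at_top[of 0]
    proof eventually_elim
      case (elim T)
      define q where "q = nat \<lfloor>T / S\<rfloor>"
      have q: "real q \<le> T / S" "T / S < real q + 1"
        using elim(2) S(1) unfolding q_def by (auto simp: le_floor_iff)
      then have q': "real q * S \<le> T" "T - S < real q * S"
        using S(1) by (auto simp: field_simps)
      have "?g T \<le> ell T \<omega>"
      proof (rule ell_ge)
        fix \<gamma> :: "real \<Rightarrow> 'a torus" assume \<gamma>: "\<gamma> \<in> geodesics"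
        have "(T - S) * ell S \<omega> \<le> real q * S * ell S \<omega>"
          using q'(2) ell_bounds(1)[OF meas S(1)] by (intro mult_right_mono) auto
        also have "\<dots> \<le> T * mean_time T \<gamma> \<omega>"
          by (rule blocks_times_ell_le_time_in_set[OF meas \<gamma> S(1) q'(1)])
        finally show "?g T \<le> mean_time T \<gamma> \<omega>"
          using elim(2) by (simp add: field_simps)
      qed
      with elim(1) show ?case
        by simp
    qed
  qed
qed

lemma
  assumes meas: "geodesically_measurable \<omega>"
  shows ell_le_Lim_ell: "S > 0 \<Longrightarrow> ell S \<omega> \<le> Lim at_top (\<lambda>T. ell T \<omega>)"
    and Lim_ell_le: "(\<And>S. S > 0 \<Longrightarrow> ell S \<omega> \<le> c) \<Longrightarrow> Lim at_top (\<lambda>T. ell T \<omega>) \<le> c"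
proof -
  have lim: "Lim at_top (\<lambda>T. ell T \<omega>) = (SUP S\<in>{0<..}. ell S \<omega>)"
    using ell_tendsto_Sup[OF meas] by (intro tendsto_Lim) auto
  have bdd: "bdd_above ((\<lambda>S. ell S \<omega>) ` {0<..})"
    using ell_bounds(2)[OF meas] by (intro bdd_aboveI2[of _ _ 1]) auto
  show "S > 0 \<Longrightarrow> ell S \<omega> \<le> Lim at_top (\<lambda>T. ell T \<omega>)"
    unfolding lim by (intro cSUP_upper bdd) auto
  show "(\<And>S. S > 0 \<Longrightarrow> ell S \<omega> \<le> c) \<Longrightarrow> Lim at_top (\<lambda>T. ell T \<omega>) \<le> c"
    unfolding lim by (intro cSUP_least) auto
qed

section \<open>The cell of a point\<close>

text \<open>The half-open cell that contains \<open>y\<close>, with indices starting from 1. Selecting this one cell puts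
  \<open>y\<close> into the checkerboard; the converse needs \<open>y\<close> off the cell walls, since the cells of the
  checkerboard are closed and neighbours share a wall.\<close>

definition cell_index :: "nat \<Rightarrow> real ^ 'd \<Rightarrow> 'd::finite \<Rightarrow> nat" where
  "cell_index n y = (\<lambda>k. nat (\<lfloor>real n * y $ k\<rfloor> mod int n) + 1)"

lemma cell_index_in: "n \<ge> 1 \<Longrightarrow> cell_index n y \<in> cell_indices n"
  by (auto simp: cell_index_def cell_indices_def Suc_le_eq nat_less_iff)

lemma cell_indices_eq_PiE: "cell_indices n = PiE UNIV (\<lambda>_. {1..n})"
  by (auto simp: cell_indices_def PiE_def Pi_def)

lemma finite_cell_indices: "finite (cell_indices n :: ('d::finite \<Rightarrow> nat) set)"
  by (simp add: cell_indices_eq_PiE finite_PiE)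

lemma card_cell_indices: "card (cell_indices n :: ('d::finite \<Rightarrow> nat) set) = n ^ CARD('d)"
  by (simp add: cell_indices_eq_PiE card_PiE)

lemma abs_torus_eq_iff: "abs_torus x = abs_torus y \<longleftrightarrow> (\<forall>k. x $ k - y $ k \<in> \<int>)"
  unfolding torus.abs_eq_iff lattice_rel_def ..

lemma abs_torus_in_cell:
  assumes "n \<ge> 1"
  shows "abs_torus y \<in> cell n (cell_index n y)"
proof -
  \<comment> \<open>the representative of \<open>y\<close> in the unit cube\<close>
  define z where "z = (\<chi> k. y $ k - of_int (\<lfloor>real n * y $ k\<rfloor> div int n))"
  have "abs_torus y = abs_torus z"
    unfolding abs_torus_eq_iff z_def by simp
  moreover have "z \<in> cbox (\<chi> k. (real (cell_index n y k) - 1) / real n)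
      (\<chi> k. real (cell_index n y k) / real n)"
  proof -
    have "(real (cell_index n y k) - 1) / real n \<le> z $ k \<and> z $ k \<le> real (cell_index n y k) / real n"
      for k
    proof -
      define m where "m = \<lfloor>real n * y $ k\<rfloor>"
      have "m = int n * (m div int n) + m mod int n"
        by simp
      then have "real_of_int m = real n * real_of_int (m div int n) + real_of_int (m mod int n)"
        by (metis of_int_add of_int_mult of_int_of_nat_eq)
      moreover have "real_of_int m \<le> real n * y $ k" "real n * y $ k \<le> real_of_int m + 1"
        unfolding m_def by linarith+
      moreover have "real (nat (m mod int n)) = real_of_int (m mod int n)"
        using assms by simp
      ultimately show ?thesis
        using assms by (simp add: z_def cell_index_def field_simps flip: m_def)
    qed
    then show ?thesis
      by (simp add: mem_box_cart)
  qed
  ultimately show ?thesis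
    unfolding cell_def by blast
qed

lemma abs_torus_in_checkerboardI:
  assumes "n \<ge> 1" "x (cell_index n y)"
  shows "abs_torus y \<in> checkerboard n x"
  using abs_torus_in_cell[OF assms(1)] cell_index_in[OF assms(1)] assms(2)
  unfolding checkerboard_def by blast

lemma cell_index_unique:
  assumes "n \<ge> 1" "i \<in> cell_indices n" "abs_torus y \<in> cell n i"
    and interior: "\<And>k. real n * y $ k \<notin> \<int>"
  shows "i = cell_index n y"
proof
  fix k
  obtain z where z: "abs_torus y = abs_torus z"
    "z \<in> cbox (\<chi> k. (real (i k) - 1) / real n) (\<chi> k. real (i k) / real n)"
    using assms(3) unfolding cell_def by blast
  then have "y $ k - z $ k \<in> \<int>"
    by (simp add: abs_torus_eq_iff)
  then obtain q where q: "y $ k - z $ k = real_of_int q"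
    by (elim Ints_cases)
  have ik: "1 \<le> i k" "i k \<le> n"
    using assms(2) by (auto simp: cell_indices_def)
  have "(real (i k) - 1) / real n \<le> z $ k" "z $ k \<le> real (i k) / real n"
    using z(2) by (auto simp: mem_box_cart)
  then have le: "real (i k) - 1 \<le> real n * z $ k" "real n * z $ k \<le> real (i k)"
    using assms(1) by (auto simp: field_simps)
  have y: "real n * y $ k = real n * z $ k + real_of_int (int n * q)"
    using q by (simp add: algebra_simps flip: q)
  have "real n * z $ k \<noteq> real (i k)"
  proof
    assume "real n * z $ k = real (i k)"
    then have "real n * y $ k = of_int (int (i k) + int n * q)"
      unfolding y by simp
    with interior show False
      by (metis Ints_of_int)
  qed
  then have "\<lfloor>real n * y $ k\<rfloor> = int (i k) - 1 + int n * q"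
    using le unfolding y by (intro floor_unique) auto
  then have "\<lfloor>real n * y $ k\<rfloor> mod int n = int (i k) - 1"
    using ik by simp
  then show "i k = cell_index n y k"
    using ik by (simp add: cell_index_def)
qed

lemma abs_torus_in_checkerboardD:
  assumes "n \<ge> 1" "abs_torus y \<in> checkerboard n x" "\<And>k. real n * y $ k \<notin> \<int>"
  shows "x (cell_index n y)"
  using cell_index_unique[OF assms(1) _ _ assms(3)] assms(2)
  unfolding checkerboard_def by blast

text \<open>A geodesic lifts to a line in Euclidean space, and it is in a cell when the line is in one of the
  countably many lattice translates of the closed box.\<close>

lemma geodesically_measurable_checkerboard:
  "geodesically_measurable (checkerboard n x :: 'd::finite torus set)"
  unfolding geodesically_measurable_def
proof
  fix \<gamma> :: "real \<Rightarrow> 'd torus" assume "\<gamma> \<in> geodesics"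
  then obtain p v where \<gamma>: "\<gamma> = (\<lambda>t. abs_torus (p + t *\<^sub>R v))"
    unfolding geodesics_def by blast
  \<comment> \<open>the lattice\<close>
  define Z where "Z = {z :: real ^ 'd. \<forall>k. z $ k \<in> \<int>}"
  have "Z \<subseteq> (\<lambda>f. \<chi> k. real_of_int (f k)) ` UNIV"
  proof
    fix z assume "z \<in> Z"
    then show "z \<in> (\<lambda>f. \<chi> k. real_of_int (f k)) ` UNIV"
      by (intro image_eqI[where x = "\<lambda>k. \<lfloor>z $ k\<rfloor>"]) (auto simp: Z_def vec_eq_iff)
  qed
  then have Z: "countable Z"
    by (rule countable_subset) (intro countable_image, simp)
  have cell: "{t. \<gamma> t \<in> cell n i} \<in> sets borel" for i
  proof -
    define B where "B = cbox (\<chi> k. (real (i k) - 1) / real n) (\<chi> k. real (i k) / real n)"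
    have "{t. \<gamma> t \<in> cell n i} = (\<Union>z\<in>Z. (\<lambda>t. p + t *\<^sub>R v - z) -` B)"
    proof (intro set_eqI iffI)
      fix t assume "t \<in> {t. \<gamma> t \<in> cell n i}"
      then obtain b where b: "b \<in> B" "abs_torus (p + t *\<^sub>R v) = abs_torus b"
        unfolding \<gamma> cell_def B_def by blast
      then have "p + t *\<^sub>R v - b \<in> Z"
        by (simp add: abs_torus_eq_iff Z_def)
      moreover have "p + t *\<^sub>R v - (p + t *\<^sub>R v - b) \<in> B"
        using b by simp
      ultimately show "t \<in> (\<Union>z\<in>Z. (\<lambda>t. p + t *\<^sub>R v - z) -` B)"
        by blast
    next
      fix t assume "t \<in> (\<Union>z\<in>Z. (\<lambda>t. p + t *\<^sub>R v - z) -` B)"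
      then obtain z where z: "z \<in> Z" "p + t *\<^sub>R v - z \<in> B"
        by blast
      then have "abs_torus (p + t *\<^sub>R v) = abs_torus (p + t *\<^sub>R v - z)"
        by (simp add: abs_torus_eq_iff Z_def)
      with z(2) show "t \<in> {t. \<gamma> t \<in> cell n i}"
        unfolding \<gamma> cell_def B_def by auto
    qed
    also have "\<dots> \<in> sets borel"
      unfolding B_def
      by (intro sets.countable_UN'' Z borel_closed closed_vimage closed_cbox continuous_intros)
    finally show ?thesis .
  qed
  have "{t. \<gamma> t \<in> checkerboard n x} = (\<Union>i\<in>{i \<in> cell_indices n. x i}. {t. \<gamma> t \<in> cell n i})"
    unfolding checkerboard_def by blast
  also have "\<dots> \<in> sets borel"
    using finite_cell_indices by (intro sets.finite_UN cell) (auto intro: rev_finite_subset)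
  finally show "{t. \<gamma> t \<in> checkerboard n x} \<in> sets borel" .
qed

section \<open>The limit is at most the density of the checkerboard\<close>

text \<open>An infimum is at most any average. The average here runs over the grid translates of a single
  geodesic. Its direction has equal nonzero coordinates, so that it lies on the cell walls only at
  countably many times; at all other times the translates are spread over the cells injectively.\<close>

lemma ell_checkerboard_le_density:
  fixes x :: "('d::finite \<Rightarrow> nat) \<Rightarrow> bool"
  assumes n: "n \<ge> 1" and "T > 0"
  shows "ell T (checkerboard n x) \<le> (\<Sum>i\<in>cell_indices n. of_bool (x i)) / real n ^ CARD('d)"
proof -
  define r where "r = 1 / sqrt (real CARD('d))"
  have r: "r > 0"
    by (simp add: r_def)
  define v :: "real ^ 'd" where "v = (\<chi> k. r)"
  have "norm v = 1"
    by (simp add: v_def norm_vec_def L2_set_def r_def power_divide)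
  define \<gamma> where "\<gamma> p t = abs_torus ((\<chi> k. real (p k) / real n) + t *\<^sub>R v)" for p and t
  have \<gamma>: "\<gamma> p \<in> geodesics" for p
    unfolding geodesics_def \<gamma>_def using \<open>norm v = 1\<close> by blast
  let ?\<omega> = "checkerboard n x"
  let ?f = "\<lambda>p t. indicator ?\<omega> (\<gamma> p t) :: real"
  define C where "C = (\<Sum>i\<in>cell_indices n. of_bool (x i) :: real)"
  \<comment> \<open>the times at which the translates are on a cell wall\<close>
  define N where "N = {t. real n * (t * r) \<in> \<int>}"
  have "N \<subseteq> (\<lambda>m. m / (real n * r)) ` \<int>"
    unfolding N_def using n r by (auto intro!: rev_image_eqI simp: field_simps)
  then have "countable N"
    by (rule countable_subset) (simp add: Ints_def)
  then have "negligible N"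
    using negligible_iff_null_sets countable_imp_null_set_lborel null_sets_completionI by blast
  have meas: "geodesically_measurable ?\<omega>"
    by (rule geodesically_measurable_checkerboard)
  have sum_le: "(\<Sum>p\<in>cell_indices n. ?f p t) \<le> C" if "t \<notin> N" for t
  proof -
    define y where "y p = ((\<chi> k. real (p k) / real n) + t *\<^sub>R v)" for p :: "'d \<Rightarrow> nat"
    define m where "m = \<lfloor>real n * (t * r)\<rfloor>"
    have y: "real n * y p $ k = of_int (int (p k)) + real n * (t * r)" for p k
      using n by (simp add: y_def v_def field_simps)
    have idx: "cell_index n (y p) k = nat ((int (p k) + m) mod int n) + 1" for p k
      unfolding cell_index_def y m_def by (simp only: int_add_floor)
    have interior: "real n * y p $ k \<notin> \<int>" for p k
      using that by (simp add: y N_def)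
    have inj: "inj_on (\<lambda>p. cell_index n (y p)) (cell_indices n)"
    proof (rule inj_onI, rule ext)
      fix p q k assume pq: "p \<in> cell_indices n" "q \<in> cell_indices n"
        and eq: "cell_index n (y p) = cell_index n (y q)"
      have "nat ((int (p k) + m) mod int n) = nat ((int (q k) + m) mod int n)"
        using fun_cong[OF eq, of k] by (simp add: idx)
      then have "(int (p k) + m) mod int n = (int (q k) + m) mod int n"
        using n by (simp add: eq_nat_nat_iff)
      then have "int n dvd int (p k) - int (q k)"
        by (simp add: mod_eq_dvd_iff)
      moreover have "\<bar>int (p k) - int (q k)\<bar> < int n"
        using pq n by (auto simp: cell_indices_def abs_less_iff dest!: spec[of _ k])
      ultimately show "p k = q k"
        using dvd_imp_le_int[of "int (p k) - int (q k)" "int n"] by auto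
    qed
    have "(\<Sum>p\<in>cell_indices n. ?f p t) = (\<Sum>p\<in>cell_indices n. of_bool (x (cell_index n (y p))))"
    proof (intro sum.cong refl)
      fix p
      show "?f p t = of_bool (x (cell_index n (y p)))"
        using abs_torus_in_checkerboardI[OF n, of x "y p"]
          abs_torus_in_checkerboardD[OF n _ interior, of p x]
        by (auto simp: \<gamma>_def y_def indicator_def)
    qed
    also have "\<dots> = (\<Sum>i\<in>(\<lambda>p. cell_index n (y p)) ` cell_indices n. of_bool (x i))"
      using inj by (simp add: sum.reindex)
    also have "\<dots> \<le> C"
      unfolding C_def using cell_index_in[OF n] finite_cell_indices by (intro sum_mono2) auto
    finally show ?thesis .
  qed
  have "real n ^ CARD('d) * ell T ?\<omega> = (\<Sum>p\<in>(cell_indices n :: ('d \<Rightarrow> nat) set). ell T ?\<omega>)"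
    by (simp add: card_cell_indices)
  also have "\<dots> \<le> (\<Sum>p\<in>cell_indices n. mean_time T (\<gamma> p) ?\<omega>)"
    by (intro sum_mono ell_le_mean_time meas \<gamma> \<open>T > 0\<close>)
  also have "\<dots> = (\<Sum>p\<in>cell_indices n. integral {0..T} (?f p)) / T"
    by (simp add: mean_time_eq[OF meas \<gamma>] sum_divide_distrib)
  also have "(\<Sum>p\<in>cell_indices n. integral {0..T} (?f p)) =
      integral {0..T} (\<lambda>t. \<Sum>p\<in>cell_indices n. ?f p t)"
    by (intro Henstock_Kurzweil_Integration.integral_sum[symmetric] finite_cell_indices
        indicator_geodesic_integrable meas \<gamma>)
  also have "integral {0..T} (\<lambda>t. \<Sum>p\<in>cell_indices n. ?f p t) \<le>
      integral {0..T} (\<lambda>t. if t \<in> N then \<Sum>p\<in>cell_indices n. ?f p t else C)"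
  proof (rule integral_le)
    show "(\<lambda>t. \<Sum>p\<in>cell_indices n. ?f p t) integrable_on {0..T}"
      using finite_cell_indices indicator_geodesic_integrable[OF meas \<gamma>] by (intro Henstock_Kurzweil_Integration.integrable_sum)
    show "(\<lambda>t. if t \<in> N then \<Sum>p\<in>cell_indices n. ?f p t else C) integrable_on {0..T}"
      by (rule integrable_spike[OF integrable_const_ivl[of C] \<open>negligible N\<close>]) auto
  qed (use sum_le in auto)
  also have "integral {0..T} (\<lambda>t. if t \<in> N then \<Sum>p\<in>cell_indices n. ?f p t else C) =
      integral {0..T} (\<lambda>_. C)"
    by (rule integral_spike[OF \<open>negligible N\<close>]) auto
  finally show ?thesis
    using \<open>T > 0\<close> n by (simp add: C_def field_simps divide_right_mono)
qed

section \<open>Counting digital lines\<close>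

definition bounded_fractions :: "nat \<Rightarrow> nat \<Rightarrow> real set" where
  "bounded_fractions N D =
     (\<lambda>(p, q). of_int p / real q) ` ({- int (N * D)..int (N * D)} \<times> {1..N})"

lemma finite_bounded_fractions: "finite (bounded_fractions N D)"
  by (simp add: bounded_fractions_def)

lemma card_bounded_fractions: "card (bounded_fractions N D) \<le> (2 * N * D + 1) * N"
proof -
  have "card (bounded_fractions N D) \<le> card ({- int (N * D)..int (N * D)} \<times> {1..N})"
    unfolding bounded_fractions_def by (intro card_image_le) auto
  also have "\<dots> = (2 * N * D + 1) * N"
    by (simp add: card_cartesian_product nat_add_distrib nat_mult_distrib algebra_simps)
  finally show ?thesis .
qed

text \<open>The largest fraction \<open>r = \<lfloor>k b\<rfloor> / k\<close> with \<open>k \<le> N\<close> does not exceed \<open>b\<close>, which bounds \<open>\<lfloor>k r\<rfloor>\<close> from above, and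
  is at least \<open>\<lfloor>k b\<rfloor> / k\<close> for every \<open>k\<close>, which bounds it from below.\<close>

lemma floor_multiples_eq_bounded_fraction:
  fixes b :: real
  assumes "N \<ge> 1" "\<bar>b\<bar> \<le> real D"
  shows "\<exists>r\<in>bounded_fractions N D. \<forall>k\<le>N. \<lfloor>real k * b\<rfloor> = \<lfloor>real k * r\<rfloor>"
proof -
  define B where "B = (\<lambda>k. of_int \<lfloor>real k * b\<rfloor> / real k) ` {1..N}"
  define r where "r = Max B"
  have B: "finite B" "B \<noteq> {}"
    using assms(1) by (auto simp: B_def)
  have "r \<in> B"
    unfolding r_def using B by (rule Max_in)
  moreover have "B \<subseteq> bounded_fractions N D"
  proof
    fix z assume "z \<in> B"
    then obtain k where k: "1 \<le> k" "k \<le> N" "z = of_int \<lfloor>real k * b\<rfloor> / real k"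
      by (auto simp: B_def)
    have "\<bar>real k * b\<bar> \<le> real N * real D"
      unfolding abs_mult using k assms(2) by (intro mult_mono) auto
    then have "\<lfloor>real k * b\<rfloor> \<in> {- int (N * D)..int (N * D)}"
      by (auto simp: le_floor_iff floor_le_iff)
    then show "z \<in> bounded_fractions N D"
      unfolding bounded_fractions_def using k
      by (intro image_eqI[where x = "(\<lfloor>real k * b\<rfloor>, k)"]) auto
  qed
  moreover have "\<lfloor>real k * b\<rfloor> = \<lfloor>real k * r\<rfloor>" if "k \<le> N" for k
  proof (cases "k = 0")
    case False
    have "r \<le> b"
      unfolding r_def using B by (auto simp: B_def field_simps)
    then have "\<lfloor>real k * r\<rfloor> \<le> \<lfloor>real k * b\<rfloor>"
      by (intro floor_mono mult_left_mono) auto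
    moreover have "of_int \<lfloor>real k * b\<rfloor> / real k \<le> r"
      unfolding r_def using that False B(1) by (intro Max_ge) (auto simp: B_def)
    then have "\<lfloor>real k * b\<rfloor> \<le> \<lfloor>real k * r\<rfloor>"
      using False by (simp add: le_floor_iff field_simps)
    ultimately show ?thesis
      by simp
  qed simp
  ultimately show ?thesis
    by blast
qed

text \<open>Lower the line until it first meets a lattice point, say above \<open>m\<close>. This is the \<open>m\<close> for which
  \<open>a + m b\<close> has the smallest fractional part, and subtracting this part from every \<open>a + j b\<close> leaves all
  the floors unchanged.\<close>

lemma digital_line_through_lattice_point:
  fixes a b :: real
  assumes "N \<ge> 1"
  obtains m c where "m < N"
    "\<And>j. j < N \<Longrightarrow> \<lfloor>a + real j * b\<rfloor> = c + \<lfloor>(real j - real m) * b\<rfloor>"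
proof -
  define f where "f j = frac (a + real j * b)" for j :: nat
  obtain m where m: "m < N" "\<And>j. j < N \<Longrightarrow> f m \<le> f j"
    using ex_is_arg_min_if_finite[of "{..<N}" f] assms
    by (auto simp: is_arg_min_linorder lessThan_empty_iff)
  have "\<lfloor>a + real j * b\<rfloor> = \<lfloor>a + real m * b\<rfloor> + \<lfloor>(real j - real m) * b\<rfloor>" if "j < N" for j
  proof -
    have "0 \<le> f m" "f j < 1"
      by (auto simp: f_def frac_lt_1)
    moreover have "(real j - real m) * b =
        of_int (\<lfloor>a + real j * b\<rfloor> - \<lfloor>a + real m * b\<rfloor>) + (f j - f m)"
      by (simp add: f_def frac_def algebra_simps)
    ultimately have "\<lfloor>(real j - real m) * b\<rfloor> = \<lfloor>a + real j * b\<rfloor> - \<lfloor>a + real m * b\<rfloor>"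
      using m(2)[OF that] by (intro floor_unique) auto
    then show ?thesis
      by simp
  qed
  with m(1) that show thesis
    by blast
qed

text \<open>Height is only recorded modulo \<open>n\<close>, as on the torus; without this there would be infinitely many
  digital lines.\<close>

definition digital_lines :: "nat \<Rightarrow> nat \<Rightarrow> nat \<Rightarrow> (nat \<Rightarrow> int) set" where
  "digital_lines N n D =
     {\<lambda>j\<in>{..<N}. \<lfloor>a + real j * b\<rfloor> mod int n | a b. \<bar>b\<bar> \<le> real D}"

text \<open>A line through the lattice point above \<open>m\<close> consists of two rays. To the right of \<open>m\<close> it follows the
  floors of multiples of \<open>b\<close>, to the left those of multiples of \<open>- b\<close>, and each family is reproduced by
  a bounded fraction. The two fractions differ in general: the first approximates \<open>b\<close> from below, the
  second amounts to an approximation from above.\<close>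

lemma
  assumes "N \<ge> 1" "n \<ge> 1"
  shows finite_digital_lines: "finite (digital_lines N n D)"
    and card_digital_lines: "card (digital_lines N n D) \<le> N * n * ((2 * N * D + 1) * N)\<^sup>2"
proof -
  let ?P = "{..<N} \<times> {0..<int n} \<times> bounded_fractions N D \<times> bounded_fractions N D"
  let ?line = "\<lambda>(m, c, r, r'). \<lambda>j\<in>{..<N}.
      (c + (if m \<le> j then \<lfloor>real (j - m) * r\<rfloor> else \<lfloor>real (m - j) * r'\<rfloor>)) mod int n"
  have sub: "digital_lines N n D \<subseteq> ?line ` ?P"
  proof
    fix g assume "g \<in> digital_lines N n D"
    then obtain a b where g: "g = (\<lambda>j\<in>{..<N}. \<lfloor>a + real j * b\<rfloor> mod int n)" and b: "\<bar>b\<bar> \<le> real D"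
      by (auto simp: digital_lines_def)
    obtain m c where m: "m < N"
      "\<And>j. j < N \<Longrightarrow> \<lfloor>a + real j * b\<rfloor> = c + \<lfloor>(real j - real m) * b\<rfloor>"
      using digital_line_through_lattice_point[OF assms(1)] by blast
    obtain r where r: "r \<in> bounded_fractions N D" "\<And>k. k \<le> N \<Longrightarrow> \<lfloor>real k * b\<rfloor> = \<lfloor>real k * r\<rfloor>"
      using floor_multiples_eq_bounded_fraction[OF assms(1) b] by blast
    obtain r' where r': "r' \<in> bounded_fractions N D"
      "\<And>k. k \<le> N \<Longrightarrow> \<lfloor>real k * (- b)\<rfloor> = \<lfloor>real k * r'\<rfloor>"
      using floor_multiples_eq_bounded_fraction[of N "- b" D] assms(1) b by auto
    have "g = ?line (m, c mod int n, r, r')"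
    proof -
      have "\<lfloor>(real j - real m) * b\<rfloor> =
          (if m \<le> j then \<lfloor>real (j - m) * r\<rfloor> else \<lfloor>real (m - j) * r'\<rfloor>)" if "j < N" for j
      proof (cases "m \<le> j")
        case True
        then show ?thesis
          using r(2)[of "j - m"] that by (simp add: of_nat_diff)
      next
        case False
        then have "(real j - real m) * b = real (m - j) * (- b)"
          by (simp add: of_nat_diff algebra_simps)
        moreover have "\<lfloor>real (m - j) * (- b)\<rfloor> = \<lfloor>real (m - j) * r'\<rfloor>"
          using m(1) by (intro r'(2)) simp
        ultimately show ?thesis
          using False by (simp only: if_False)
      qed
      then show ?thesis
        unfolding g by (simp add: m(2) fun_eq_iff restrict_def mod_add_left_eq)
    qed
    moreover have "(m, c mod int n, r, r') \<in> ?P"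
      using m(1) r(1) r'(1) assms(2) by simp
    ultimately show "g \<in> ?line ` ?P"
      by (rule image_eqI)
  qed
  have fin: "finite ?P"
    using finite_bounded_fractions by simp
  show "finite (digital_lines N n D)"
    using sub fin by (meson finite_imageI finite_subset)
  have "card (digital_lines N n D) \<le> card ?P"
    using sub fin by (meson card_image_le card_mono finite_imageI order_trans)
  also have "\<dots> = N * n * (card (bounded_fractions N D))\<^sup>2"
    by (simp add: card_cartesian_product power2_eq_square)
  also have "\<dots> \<le> N * n * ((2 * N * D + 1) * N)\<^sup>2"
    by (intro mult_left_mono power_mono card_bounded_fractions) auto
  finally show "card (digital_lines N n D) \<le> N * n * ((2 * N * D + 1) * N)\<^sup>2" .
qed

section \<open>Sampling a geodesic\<close>

text \<open>The sampling step is \<open>d / n\<close>: a factor \<open>d\<close> more than the side of a cell and hence longer than a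
  diagonal (unless \<open>d = 1\<close>, when half-openness of the cells makes up for it), and such that in units
  of cells each coordinate advances by \<open>d * v $ k\<close>, with a bound that does not depend on \<open>n\<close>. A
  sample is recorded as a set of cells, over which the Bernoulli variables will be summed.\<close>

definition sample_cells :: "nat \<Rightarrow> nat \<Rightarrow> ('d::finite \<Rightarrow> nat) set set" where
  "sample_cells n N =
     {(\<lambda>j. cell_index n (y + (real j * (real CARD('d) / real n)) *\<^sub>R v)) ` {..<N} | y v. norm v = 1}"

lemma cell_index_sample:
  assumes "n \<ge> 1"
  shows "cell_index n (y + (real j * (real D / real n)) *\<^sub>R v) k =
    nat (\<lfloor>real n * y $ k + real j * (real D * v $ k)\<rfloor> mod int n) + 1"
proof -
  have "real n * (y + (real j * (real D / real n)) *\<^sub>R v) $ k =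
      real n * y $ k + real j * (real D * v $ k)"
    using assms by (simp add: field_simps)
  then show ?thesis
    by (simp only: cell_index_def)
qed

text \<open>Each coordinate of the visited cells runs through a digital line of slope at most \<open>d\<close>, and the
  count allows for every combination of such lines.\<close>

lemma
  assumes "N \<ge> 1" "n \<ge> 1"
  shows finite_sample_cells: "finite (sample_cells n N :: ('d::finite \<Rightarrow> nat) set set)"
    and card_sample_cells: "card (sample_cells n N :: ('d \<Rightarrow> nat) set set) \<le>
      (N * n * ((2 * N * CARD('d) + 1) * N)\<^sup>2) ^ CARD('d)"
proof -
  let ?L = "digital_lines N n CARD('d)"
  let ?P = "PiE (UNIV :: 'd set) (\<lambda>_. ?L)"
  let ?cells = "\<lambda>g. (\<lambda>j k. nat (g k j) + 1) ` {..<N}"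
  have sub: "(sample_cells n N :: ('d \<Rightarrow> nat) set set) \<subseteq> ?cells ` ?P"
  proof
    fix I :: "('d \<Rightarrow> nat) set" assume "I \<in> sample_cells n N"
    then obtain y v :: "real ^ 'd" where v: "norm v = 1"
      and I: "I = (\<lambda>j. cell_index n (y + (real j * (real CARD('d) / real n)) *\<^sub>R v)) ` {..<N}"
      unfolding sample_cells_def by blast
    define g where "g k =
      (\<lambda>j\<in>{..<N}. \<lfloor>real n * y $ k + real j * (real CARD('d) * v $ k)\<rfloor> mod int n)" for k
    have "\<bar>real CARD('d) * v $ k\<bar> \<le> real CARD('d)" for k
      using component_le_norm_cart[of v k] v by (simp add: abs_mult)
    then have "g \<in> ?P"
      unfolding g_def digital_lines_def by (auto simp: PiE_def)
    moreover have "I = ?cells g"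
      unfolding I
      by (intro image_cong refl ext) (subst cell_index_sample[OF assms(2)], simp add: g_def)
    ultimately show "I \<in> ?cells ` ?P"
      by blast
  qed
  have fin: "finite ?P"
    using finite_digital_lines[OF assms] by (intro finite_PiE) auto
  show "finite (sample_cells n N :: ('d \<Rightarrow> nat) set set)"
    using sub fin by (meson finite_imageI finite_subset)
  have "card (sample_cells n N :: ('d \<Rightarrow> nat) set set) \<le> card ?P"
    using sub fin by (meson card_image_le card_mono finite_imageI order_trans)
  also have "\<dots> = card ?L ^ CARD('d)"
    by (simp add: card_PiE)
  also have "\<dots> \<le> (N * n * ((2 * N * CARD('d) + 1) * N)\<^sup>2) ^ CARD('d)"
    by (intro power_mono card_digital_lines assms) auto
  finally show "card (sample_cells n N :: ('d \<Rightarrow> nat) set set) \<le>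
      (N * n * ((2 * N * CARD('d) + 1) * N)\<^sup>2) ^ CARD('d)" .
qed

text \<open>All samples lie within distance \<open>1/2\<close>, so two of them in the same cell of the torus are in the same
  cell of Euclidean space. All their coordinates then differ by less than \<open>1 / n\<close>, and their \<open>l\<^sup>1\<close>
  distance is less than \<open>d / n\<close>, which is the distance between consecutive samples.\<close>

lemma inj_on_sample_cells:
  fixes y v :: "real ^ 'd::finite"
  assumes n: "n \<ge> 1" "2 * CARD('d) * N \<le> n" and v: "norm v = 1"
  shows "inj_on (\<lambda>j. cell_index n (y + (real j * (real CARD('d) / real n)) *\<^sub>R v)) {..<N}"
proof (rule inj_onI)
  fix i j assume ij: "i \<in> {..<N}" "j \<in> {..<N}"
  let ?D = "real CARD('d)"
  \<comment> \<open>the coordinates of the samples in units of cells\<close>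
  define u where "u j k = real n * y $ k + real j * (?D * v $ k)" for j :: nat and k
  assume "cell_index n (y + (real i * (?D / real n)) *\<^sub>R v) =
    cell_index n (y + (real j * (?D / real n)) *\<^sub>R v)"
  then have "\<forall>k. nat (\<lfloor>u i k\<rfloor> mod int n) = nat (\<lfloor>u j k\<rfloor> mod int n)"
    unfolding u_def fun_eq_iff cell_index_sample[OF n(1)] by simp
  then have cong: "\<lfloor>u i k\<rfloor> mod int n = \<lfloor>u j k\<rfloor> mod int n" for k
    using n(1) by (simp add: eq_nat_nat_iff)
  have diff: "u i k - u j k = ?D * (real i - real j) * v $ k" for k
    by (simp add: u_def algebra_simps)
  have less_1: "\<bar>?D * (real i - real j) * v $ k\<bar> < 1" for k
  proof -
    have "\<bar>u i k - u j k\<bar> \<le> real n / 2"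
    proof -
      have "\<bar>u i k - u j k\<bar> \<le> ?D * real N * 1"
        unfolding diff abs_mult
        using ij component_le_norm_cart[of v k] v by (intro mult_mono) auto
      also have "\<dots> = real (2 * CARD('d) * N) / 2"
        by simp
      also have "\<dots> \<le> real n / 2"
        using n(2) by (intro divide_right_mono of_nat_mono) auto
      finally show ?thesis .
    qed
    moreover have "2 \<le> n"
    proof -
      have "1 \<le> CARD('d) * N"
        using ij by (simp add: Suc_le_eq)
      with n(2) show ?thesis
        by linarith
    qed
    ultimately have "\<bar>\<lfloor>u i k\<rfloor> - \<lfloor>u j k\<rfloor>\<bar> < int n"
      by linarith
    moreover have "int n dvd \<lfloor>u i k\<rfloor> - \<lfloor>u j k\<rfloor>"
      using cong[of k] by (simp add: mod_eq_dvd_iff)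
    ultimately have "\<lfloor>u i k\<rfloor> = \<lfloor>u j k\<rfloor>"
      using dvd_imp_le_int[of "\<lfloor>u i k\<rfloor> - \<lfloor>u j k\<rfloor>" "int n"] by auto
    then show ?thesis
      unfolding diff[symmetric] by linarith
  qed
  have "?D * \<bar>real i - real j\<bar> = norm ((?D * (real i - real j)) *\<^sub>R v)"
    using v by (simp add: abs_mult)
  also have "\<dots> \<le> (\<Sum>k\<in>UNIV. \<bar>?D * (real i - real j) * v $ k\<bar>)"
    using norm_le_l1_cart[of "(?D * (real i - real j)) *\<^sub>R v"] by simp
  also have "\<dots> < (\<Sum>k\<in>(UNIV :: 'd set). 1)"
    using less_1 by (intro sum_strict_mono) auto
  finally show "i = j"
    by simp
qed

text \<open>The time that a geodesic spends in the checkerboard up to time \<open>N h\<close> is the integral over the phase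
  \<open>s \<in> [0, h]\<close> of the number of samples \<open>s + j h\<close> at which it is there. Each phase gives an admissible
  sample, and each selected cell of the sample accounts for one such visit because its cells are
  distinct.\<close>

lemma Lim_ell_checkerboard_ge:
  fixes x :: "('d::finite \<Rightarrow> nat) \<Rightarrow> bool"
  assumes n: "n \<ge> 1" "2 * CARD('d) * N \<le> n" and "N \<ge> 1"
    and samples: "\<And>I. I \<in> sample_cells n N \<Longrightarrow> real N * c \<le> (\<Sum>i\<in>I. of_bool (x i))"
  shows "c \<le> Lim at_top (\<lambda>T. ell T (checkerboard n x))"
proof -
  let ?\<omega> = "checkerboard n x"
  define h where "h = real CARD('d) / real n"
  have "h > 0"
    using n(1) by (simp add: h_def)
  then have "real N * h > 0"
    using \<open>N \<ge> 1\<close> by simp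
  have meas: "geodesically_measurable ?\<omega>"
    by (rule geodesically_measurable_checkerboard)
  have "c \<le> ell (real N * h) ?\<omega>"
  proof (rule ell_ge)
    fix \<gamma> :: "real \<Rightarrow> 'd torus" assume \<gamma>: "\<gamma> \<in> geodesics"
    then obtain y v where v: "norm v = 1" and \<gamma>_eq: "\<gamma> = (\<lambda>t. abs_torus (y + t *\<^sub>R v))"
      unfolding geodesics_def by blast
    let ?f = "\<lambda>t. indicator ?\<omega> (\<gamma> t) :: real"
    have ge: "real N * c \<le> (\<Sum>j<N. ?f (real j * h + s))" for s
    proof -
      define g where "g j = cell_index n ((y + s *\<^sub>R v) + (real j * h) *\<^sub>R v)" for j :: nat
      have "g ` {..<N} \<in> sample_cells n N"
        unfolding sample_cells_def g_def h_def using v by blast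
      then have "real N * c \<le> (\<Sum>i\<in>g ` {..<N}. of_bool (x i))"
        by (rule samples)
      also have "\<dots> = (\<Sum>j<N. of_bool (x (g j)))"
        using inj_on_sample_cells[OF n v] unfolding g_def h_def
        by (subst sum.reindex) (simp_all only: o_def)
      also have "\<dots> \<le> (\<Sum>j<N. ?f (real j * h + s))"
      proof (rule sum_mono)
        fix j
        have "x (g j) \<Longrightarrow> \<gamma> (real j * h + s) \<in> ?\<omega>"
          using abs_torus_in_checkerboardI[OF n(1), of x] unfolding g_def \<gamma>_eq
          by (simp add: algebra_simps)
        then show "of_bool (x (g j)) \<le> ?f (real j * h + s)"
          by simp
      qed
      finally show ?thesis .
    qed
    have int: "(\<lambda>s. ?f (real j * h + s)) integrable_on {0..h}" for j
      using indicator_geodesic_integrable[OF meas geodesic_shift[OF \<gamma>]] .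
    have "h * (real N * c) = integral {0..h} (\<lambda>_. real N * c)"
      using \<open>h > 0\<close> by simp
    also have "\<dots> \<le> integral {0..h} (\<lambda>s. \<Sum>j<N. ?f (real j * h + s))"
      by (intro integral_le Henstock_Kurzweil_Integration.integrable_sum int ge) auto
    also have "\<dots> = (\<Sum>j<N. integral {0..h} (\<lambda>s. ?f (real j * h + s)))"
      by (intro Henstock_Kurzweil_Integration.integral_sum int) auto
    also have "\<dots> = integral {0..real N * h} ?f"
      using \<open>h > 0\<close> by (intro integral_blocks[symmetric] indicator_geodesic_integrable meas \<gamma>) auto
    finally show "c \<le> mean_time (real N * h) \<gamma> ?\<omega>"
      unfolding mean_time_eq[OF meas \<gamma>] using \<open>real N * h > 0\<close>
      by (simp add: pos_le_divide_eq algebra_simps)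
  qed
  also have "\<dots> \<le> Lim at_top (\<lambda>T. ell T ?\<omega>)"
    by (rule ell_le_Lim_ell[OF meas \<open>real N * h > 0\<close>])
  finally show ?thesis .
qed

section \<open>Large deviations\<close>

lemma iid_bernoulli_cells_Hoeffding:
  fixes X :: "('d::finite \<Rightarrow> nat) \<Rightarrow> 'a \<Rightarrow> bool"
  assumes "prob_space M" and iid: "iid_bernoulli_cells M n \<epsilon> X" and \<epsilon>: "0 \<le> \<epsilon>" "\<epsilon> \<le> 1"
    and I: "I \<subseteq> cell_indices n" "I \<noteq> {}" and "\<delta> \<ge> 0"
  shows "measure M {s \<in> space M. (\<Sum>i\<in>I. of_bool (X i s)) \<ge> real (card I) * (\<epsilon> + \<delta>)}
      \<le> exp (- 2 * real (card I) * \<delta>\<^sup>2)" (is "measure M ?U \<le> _")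
    and "measure M {s \<in> space M. (\<Sum>i\<in>I. of_bool (X i s)) \<le> real (card I) * (\<epsilon> - \<delta>)}
      \<le> exp (- 2 * real (card I) * \<delta>\<^sup>2)" (is "measure M ?L \<le> _")
    and "{s \<in> space M. (\<Sum>i\<in>I. of_bool (X i s)) \<ge> real (card I) * (\<epsilon> + \<delta>)} \<in> sets M"
    and "{s \<in> space M. (\<Sum>i\<in>I. of_bool (X i s)) \<le> real (card I) * (\<epsilon> - \<delta>)} \<in> sets M"
proof -
  interpret prob_space M by fact
  have indep: "indep_vars (\<lambda>_. count_space UNIV) X I"
    using iid I(1) by (auto simp: iid_bernoulli_cells_def intro: indep_vars_subset)
  have rv: "X i \<in> M \<rightarrow>\<^sub>M count_space UNIV" if "i \<in> I" for i
    using indep that by (auto simp: indep_vars_def)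
  have distr: "distr M (count_space UNIV) (X i) = measure_pmf (bernoulli_pmf \<epsilon>)" if "i \<in> I" for i
    using iid I(1) that by (auto simp: iid_bernoulli_cells_def)
  let ?Y = "\<lambda>i s. of_bool (X i s) :: real"
  have Y: "?Y i \<in> borel_measurable M" if "i \<in> I" for i
    using measurable_compose[OF rv[OF that], of of_bool borel] by simp
  have fin: "finite I"
    using I(1) finite_cell_indices by (rule finite_subset)
  then have card: "card I > 0"
    using I(2) by (simp add: card_gt_0_iff)
  have mean: "expectation (?Y i) = \<epsilon>" if "i \<in> I" for i
  proof -
    have "expectation (?Y i) = (\<integral>b. of_bool b \<partial>distr M (count_space UNIV) (X i))"
      by (rule integral_distr[symmetric, OF rv[OF that]]) simp
    also have "\<dots> = \<epsilon>"
      using \<epsilon> by (simp add: distr[OF that])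
    finally show ?thesis .
  qed
  interpret H: Hoeffding_ineq M I ?Y "\<lambda>_. 0" "\<lambda>_. 1" "real (card I) * \<epsilon>"
  proof unfold_locales
    show "indep_vars (\<lambda>_. borel) ?Y I"
      using indep_vars_compose2[OF indep, of "\<lambda>_. of_bool" "\<lambda>_. borel"] by simp
    show "real (card I) * \<epsilon> \<equiv> \<Sum>i\<in>I. expectation (?Y i)"
      using mean by (simp add: atomize_eq)
  qed (use fin in auto)
  have "(real (card I) * \<delta>)\<^sup>2 / real (card I) = real (card I) * \<delta>\<^sup>2"
    using card by (simp add: power2_eq_square)
  then have ex: "exp (- 2 * (real (card I) * \<delta>)\<^sup>2 / (\<Sum>i\<in>I. (1 - 0)\<^sup>2)) = exp (- 2 * real (card I) * \<delta>\<^sup>2)"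
    by (simp add: mult.assoc flip: times_divide_eq_right)
  show "prob ?U \<le> exp (- 2 * real (card I) * \<delta>\<^sup>2)"
    using H.Hoeffding_ineq_ge[of "real (card I) * \<delta>"] card \<open>\<delta> \<ge> 0\<close> unfolding ex
    by (simp add: distrib_left)
  show "prob ?L \<le> exp (- 2 * real (card I) * \<delta>\<^sup>2)"
    using H.Hoeffding_ineq_le[of "real (card I) * \<delta>"] card \<open>\<delta> \<ge> 0\<close> unfolding ex
    by (simp add: right_diff_distrib)
  have [measurable]: "(\<lambda>s. \<Sum>i\<in>I. ?Y i s) \<in> borel_measurable M"
    by (intro borel_measurable_sum Y)
  show "?U \<in> sets M" "?L \<in> sets M"
    by measurable
qed

text \<open>A deviation forces too many selected cells overall or too few on some sample. The first event and
  each event of the second kind have probability at most \<open>exp (- N \<delta>\<^sup>2 / 2)\<close>; for the first one this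
  uses that there are \<open>n\<^sup>d \<ge> N\<close> cells. There is one event of the second kind for each member of
  \<^term>\<open>sample_cells n N\<close>, whence the polynomial factor.\<close>

lemma prob_Lim_ell_checkerboard_deviates_le:
  fixes X :: "('d::finite \<Rightarrow> nat) \<Rightarrow> 'a \<Rightarrow> bool"
  assumes "prob_space M" and iid: "iid_bernoulli_cells M n \<epsilon> X" and \<epsilon>: "0 \<le> \<epsilon>" "\<epsilon> \<le> 1"
    and "\<delta> > 0" and n: "n \<ge> 1" "2 * CARD('d) * N \<le> n" and N: "N \<ge> 1"
  shows "measure M {s \<in> space M. \<bar>Lim at_top (\<lambda>T. ell T (checkerboard n (\<lambda>i. X i s))) - \<epsilon>\<bar> \<ge> \<delta>}
    \<le> (1 + real ((N * n * ((2 * N * CARD('d) + 1) * N)\<^sup>2) ^ CARD('d))) * exp (- (\<delta>\<^sup>2 / 2) * real N)"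
    (is "measure M ?dev \<le> _")
proof -
  interpret prob_space M by fact
  let ?A = "cell_indices n :: ('d \<Rightarrow> nat) set"
  let ?S = "sample_cells n N :: ('d \<Rightarrow> nat) set set"
  let ?e = "exp (- (\<delta>\<^sup>2 / 2) * real N)"
  define U where "U = {s \<in> space M. (\<Sum>i\<in>?A. of_bool (X i s)) \<ge> real (card ?A) * (\<epsilon> + \<delta> / 2)}"
  define L where "L I = {s \<in> space M. (\<Sum>i\<in>I. of_bool (X i s)) \<le> real (card I) * (\<epsilon> - \<delta> / 2)}"
    for I :: "('d \<Rightarrow> nat) set"
  have "?A \<noteq> {}"
    using cell_index_in[OF n(1)] by blast
  have S: "I \<subseteq> ?A" "I \<noteq> {}" "card I = N" if "I \<in> ?S" for I
    using that N cell_index_in[OF n(1)] card_image[OF inj_on_sample_cells[OF n]]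
    by (auto simp: sample_cells_def)
  note Hoeffding = iid_bernoulli_cells_Hoeffding[OF \<open>prob_space M\<close> iid \<epsilon>, of _ "\<delta> / 2"]
  have [measurable]: "U \<in> events"
    unfolding U_def using \<open>?A \<noteq> {}\<close> \<open>\<delta> > 0\<close> by (intro Hoeffding) auto
  have L_meas [measurable]: "L I \<in> events" if "I \<in> ?S" for I
    unfolding L_def using S[OF that] \<open>\<delta> > 0\<close> by (intro Hoeffding) auto
  have "n \<le> n ^ CARD('d)"
    using n(1) by (intro self_le_power) auto
  moreover have "N \<le> n"
  proof -
    have "1 * N \<le> 2 * CARD('d) * N"
      by (intro mult_le_mono1) (simp add: Suc_le_eq)
    with n(2) show ?thesis
      by linarith
  qed
  ultimately have "real N \<le> real (n ^ CARD('d))"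
    by linarith
  have "prob U \<le> exp (- 2 * real (card ?A) * (\<delta> / 2)\<^sup>2)"
    unfolding U_def using \<open>?A \<noteq> {}\<close> \<open>\<delta> > 0\<close> by (intro Hoeffding) auto
  also have "\<dots> = exp (- (\<delta>\<^sup>2 / 2) * real (n ^ CARD('d)))"
    by (simp add: card_cell_indices power2_eq_square)
  also have "\<dots> \<le> ?e"
    using \<open>real N \<le> real (n ^ CARD('d))\<close> by (simp add: mult_left_mono)
  finally have prob_U: "prob U \<le> ?e" .
  have prob_L: "prob (L I) \<le> ?e" if "I \<in> ?S" for I
  proof -
    have "prob (L I) \<le> exp (- 2 * real (card I) * (\<delta> / 2)\<^sup>2)"
      unfolding L_def using S[OF that] \<open>\<delta> > 0\<close> by (intro Hoeffding) auto
    also have "\<dots> = ?e"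
      by (simp add: S(3)[OF that] power2_eq_square)
    finally show ?thesis .
  qed
  have fin: "finite ?S"
    by (rule finite_sample_cells[OF N n(1)])
  have "?dev \<subseteq> U \<union> (\<Union>I\<in>?S. L I)"
  proof (rule subsetI, rule ccontr)
    fix s assume s: "s \<in> ?dev" "s \<notin> U \<union> (\<Union>I\<in>?S. L I)"
    let ?x = "\<lambda>i. X i s"
    let ?l = "Lim at_top (\<lambda>T. ell T (checkerboard n ?x))"
    have "\<epsilon> - \<delta> / 2 \<le> ?l"
    proof (rule Lim_ell_checkerboard_ge[OF n N])
      fix I assume "I \<in> ?S"
      with s have "s \<in> space M" "s \<notin> L I"
        by auto
      then show "real N * (\<epsilon> - \<delta> / 2) \<le> (\<Sum>i\<in>I. of_bool (?x i))"
        using S(3)[OF \<open>I \<in> ?S\<close>] by (simp add: L_def)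
    qed
    moreover have "?l \<le> \<epsilon> + \<delta> / 2"
    proof (rule Lim_ell_le[OF geodesically_measurable_checkerboard])
      fix T :: real assume "T > 0"
      have "(\<Sum>i\<in>?A. of_bool (?x i)) \<le> real (card ?A) * (\<epsilon> + \<delta> / 2)"
        using s by (auto simp: U_def)
      then have "(\<Sum>i\<in>?A. of_bool (?x i)) / real n ^ CARD('d) \<le> \<epsilon> + \<delta> / 2"
        using n(1) by (simp add: card_cell_indices pos_divide_le_eq mult.commute)
      with ell_checkerboard_le_density[OF n(1) \<open>T > 0\<close>, of ?x]
      show "ell T (checkerboard n ?x) \<le> \<epsilon> + \<delta> / 2"
        by (rule order_trans)
    qed
    ultimately show False
      using s(1) \<open>\<delta> > 0\<close> by auto
  qed
  moreover have UL: "(\<Union>I\<in>?S. L I) \<in> events"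
    using fin L_meas by blast
  ultimately have "prob ?dev \<le> prob (U \<union> (\<Union>I\<in>?S. L I))"
    by (intro finite_measure_mono) auto
  also have "\<dots> \<le> prob U + prob (\<Union>I\<in>?S. L I)"
    using UL by (intro measure_Un_le) auto
  also have "prob (\<Union>I\<in>?S. L I) \<le> (\<Sum>I\<in>?S. prob (L I))"
    using fin L_meas by (intro finite_measure_subadditive_finite) auto
  also have "\<dots> \<le> (\<Sum>I\<in>?S. ?e)"
    by (intro sum_mono prob_L)
  also have "\<dots> = real (card ?S) * ?e"
    by simp
  also have "\<dots> \<le> real ((N * n * ((2 * N * CARD('d) + 1) * N)\<^sup>2) ^ CARD('d)) * ?e"
    using card_sample_cells[OF N n(1), where 'd = 'd] by (intro mult_right_mono of_nat_mono) auto
  finally show ?thesis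
    using prob_U by (simp add: algebra_simps)
qed

lemma polynomial_times_exp_tendsto_0:
  assumes "c > 0"
  shows "(\<lambda>n. real n ^ k * exp (- c * real n)) \<longlonglongrightarrow> 0"
proof -
  have "filterlim (\<lambda>n. c * real n) at_top sequentially"
    using assms by (intro filterlim_tendsto_pos_mult_at_top[OF tendsto_const] filterlim_real_sequentially)
  then have "(\<lambda>n. (c * real n) ^ k / exp (c * real n)) \<longlonglongrightarrow> 0"
    by (rule filterlim_compose[OF tendsto_power_div_exp_0])
  then have "(\<lambda>n. (c * real n) ^ k / exp (c * real n) / c ^ k) \<longlonglongrightarrow> 0"
    by (rule tendsto_divide_zero)
  then show ?thesis
    using assms by (simp add: power_mult_distrib exp_minus field_simps)
qed

section \<open>Convergence in probability\<close>

theorem corollary1p9: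
  fixes M :: "nat \<Rightarrow> 'a measure"
    and X :: "nat \<Rightarrow> ('d::finite \<Rightarrow> nat) \<Rightarrow> 'a \<Rightarrow> bool"
    and \<epsilon> \<delta> :: real
  assumes "0 \<le> \<epsilon>" and "\<epsilon> \<le> 1" and "\<delta> > 0"
    and "\<And>n. n \<ge> 1 \<Longrightarrow> prob_space (M n)"
    and "\<And>n. n \<ge> 1 \<Longrightarrow> iid_bernoulli_cells (M n) n \<epsilon> (X n)"
  shows "(\<lambda>n. measure (M n) {s \<in> space (M n).
            \<bar>Lim at_top (\<lambda>T. ell T (checkerboard n (\<lambda>i. X n i s))) - \<epsilon>\<bar> \<ge> \<delta>})
         \<longlonglongrightarrow> 0"
proof -
  define D where "D = CARD('d)"
  have D: "D \<ge> 1"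
    by (simp add: D_def Suc_le_eq)
  define N where "N n = n div (2 * D)" for n
  define c where "c = \<delta>\<^sup>2 / (4 * real D)"
  define K where "K = (real (2 * D + 1))\<^sup>2 ^ D"
  \<comment> \<open>\<open>N n\<close> is at least \<open>n / (2 D) - 1\<close>, which gives the exponent \<open>- c * n\<close> and the factor in front; the
      degree 6 bounds the number of digital lines, using \<open>N n \<le> n\<close>\<close>
  let ?bound = "\<lambda>n. exp (\<delta>\<^sup>2 / 2) *
    (real n ^ 0 * exp (- c * real n) + K * (real n ^ (6 * D) * exp (- c * real n)))"
  have "c > 0"
    using \<open>\<delta> > 0\<close> D by (simp add: c_def)
  then have "?bound \<longlonglongrightarrow> exp (\<delta>\<^sup>2 / 2) * (0 + K * 0)"
    by (intro tendsto_mult tendsto_add tendsto_const polynomial_times_exp_tendsto_0)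
  then have lim: "?bound \<longlonglongrightarrow> 0"
    by simp
  show ?thesis
  proof (rule tendsto_sandwich[OF _ _ tendsto_const lim])
    show "\<forall>\<^sub>F n in sequentially. measure (M n) {s \<in> space (M n).
        \<bar>Lim at_top (\<lambda>T. ell T (checkerboard n (\<lambda>i. X n i s))) - \<epsilon>\<bar> \<ge> \<delta>} \<le> ?bound n"
      using eventually_ge_at_top[of "2 * D"]
    proof eventually_elim
      case (elim n)
      have n: "n \<ge> 1"
        using elim D by simp
      have N: "N n \<ge> 1"
        using elim D by (simp add: N_def Suc_le_eq div_greater_zero_iff)
      have Nn: "2 * D * N n \<le> n"
        unfolding N_def by (metis div_times_less_eq_dividend mult.commute)
      have "N n \<le> n"
        by (simp add: N_def)
      have "(2 * N n * D + 1) * N n \<le> ((2 * D + 1) * n) * n"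
      proof (intro mult_mono)
        have "2 * N n * D + 1 \<le> 2 * n * D + n"
          using \<open>N n \<le> n\<close> n by (intro add_mono mult_mono) auto
        then show "2 * N n * D + 1 \<le> (2 * D + 1) * n"
          by (simp add: algebra_simps)
      qed (use \<open>N n \<le> n\<close> in auto)
      then have "((2 * N n * D + 1) * N n)\<^sup>2 \<le> (((2 * D + 1) * n) * n)\<^sup>2"
        by (rule power_mono) simp
      then have "N n * n * ((2 * N n * D + 1) * N n)\<^sup>2 \<le> n * n * (((2 * D + 1) * n) * n)\<^sup>2"
        by (intro mult_le_mono \<open>N n \<le> n\<close> order_refl)
      also have "\<dots> = (2 * D + 1)\<^sup>2 * n ^ 6"
        by (simp add: power_mult_distrib eval_nat_numeral algebra_simps)
      finally have "real ((N n * n * ((2 * N n * D + 1) * N n)\<^sup>2) ^ D)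
          \<le> real (((2 * D + 1)\<^sup>2 * n ^ 6) ^ D)"
        by (intro of_nat_mono power_mono) auto
      also have "\<dots> = K * real n ^ (6 * D)"
        unfolding K_def of_nat_power of_nat_mult power_mult_distrib power_mult ..
      finally have poly: "real ((N n * n * ((2 * N n * D + 1) * N n)\<^sup>2) ^ D)
        \<le> K * real n ^ (6 * D)" .
      have "real n / (2 * real D) - 1 \<le> real (N n)"
        using floor_divide_of_nat_eq[of n "2 * D", where 'a = real] unfolding N_def
        by simp linarith
      then have "\<delta>\<^sup>2 / 2 * (real n / (2 * real D) - 1) \<le> \<delta>\<^sup>2 / 2 * real (N n)"
        by (intro mult_left_mono) auto
      then have "- (\<delta>\<^sup>2 / 2) * real (N n) \<le> \<delta>\<^sup>2 / 2 + - c * real n"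
        by (simp add: c_def algebra_simps)
      then have expo: "exp (- (\<delta>\<^sup>2 / 2) * real (N n)) \<le> exp (\<delta>\<^sup>2 / 2) * exp (- c * real n)"
        by (simp flip: exp_add)
      have "measure (M n) {s \<in> space (M n).
          \<bar>Lim at_top (\<lambda>T. ell T (checkerboard n (\<lambda>i. X n i s))) - \<epsilon>\<bar> \<ge> \<delta>}
        \<le> (1 + real ((N n * n * ((2 * N n * D + 1) * N n)\<^sup>2) ^ D)) * exp (- (\<delta>\<^sup>2 / 2) * real (N n))"
        using prob_Lim_ell_checkerboard_deviates_le[OF assms(4)[OF n] assms(5)[OF n] assms(1-3) n _ N] Nn
        unfolding D_def by blast
      also have "\<dots> \<le> (1 + K * real n ^ (6 * D)) * (exp (\<delta>\<^sup>2 / 2) * exp (- c * real n))"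
        by (intro mult_mono add_mono poly expo order_refl) (auto simp: K_def)
      also have "\<dots> = ?bound n"
        by (simp add: algebra_simps)
      finally show ?case .
    qed
  qed auto
qed

end
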